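(* Consider the (non-dimensional) three-dimensional pressure-driven spherical-shell design problem described in the context, with $0<r_i<1$, $k_H\ge k_L>0$ and $0\le\gamma\le1$. For a single-interface layout with inner permeability $k_1$, outer permeability $k_2$ and interface radius $\xi$, the velocity and the total rate of dissipation are $$v_r(r)=\frac{\Upsilon_{\mathrm{3D}}(\xi)}{r^2},\qquad \Phi(\xi)=4\pi\,\Upsilon_{\mathrm{3D}}(\xi),\qquad \Upsilon_{\mathrm{3D}}(\xi):=\left[\frac{1}{k_1 r_i}-\frac{1}{k_2}+\frac{1}{\xi}\left(\frac{1}{k_2}-\frac{1}{k_1}\right)\right]^{-1}.$$ Moreover, among all admissible single-interface layouts, the total rate of dissipation is maximized by placing the high-permeability material near the inner boundary (that is, $k_1=k_H$, $k_2=k_L$) with the material interface located at $$\widehat{\xi}_{\mathrm{3D}}=\sqrt[3]{\gamma+(1-\gamma)r_i^3}.$$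
   Context: The domain is the spherical shell $r_i<r<1$ in $\mathbb{R}^3$, where $r$ is the distance from the center and all quantities are non-dimensional (outer radius $1$, viscosity $1$). Two porous materials with permeabilities $k_H$ (high) and $k_L$ (low) fill the shell. A single-interface layout is a radially symmetric permeability field $$k(r)=k_1\ \text{ for } r_i<r<\xi,\qquad k(r)=k_2\ \text{ for }\xi<r<1,$$ where $\xi\in[r_i,1]$ and either $(k_1,k_2)=(k_H,k_L)$ or $(k_1,k_2)=(k_L,k_H)$. The layout is admissible if the volume occupied by the high-permeability material is at most $\gamma$ times the volume of the shell: this means $\xi^3-r_i^3\le\gamma(1-r_i^3)$ when $(k_1,k_2)=(k_H,k_L)$, and $1-\xi^3\le\gamma(1-r_i^3)$ when $(k_1,k_2)=(k_L,k_H)$. For a given layout, the radial velocity $v_r(r)$ and pressure $p(r)$ solve the Darcy equations $$\frac{1}{k(r)}v_r+\frac{dp}{dr}=0,\qquad \frac{1}{r^2}\frac{d(r^2 v_r)}{dr}=0\quad\text{in }(r_i,1)$$ (away from the interface), with boundary conditions $p(r_i)=1$, $p(1)=0$, and with $p$ and $v_r$ continuous at $r=\xi$. The total rate of dissipation is $$\Phi=\int_{r_i}^{1}\frac{4\pi r^2}{k(r)}\,v_r(r)^2\,dr.$$ *)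

theory Defs
  imports "HOL-Analysis.Analysis"
begin

text \<open>The value at the interface \<open>r = \<xi>\<close> is a convention: it enters neither the
  Darcy equations (imposed off the interface) nor the dissipation integral.\<close>
definition permeability :: "real \<Rightarrow> real \<Rightarrow> real \<Rightarrow> real \<Rightarrow> real" where
  "permeability k1 k2 \<xi> r = (if r < \<xi> then k1 else k2)"

definition single_interface_layout :: "real \<Rightarrow> real \<Rightarrow> real \<Rightarrow> real \<Rightarrow> real \<Rightarrow> real \<Rightarrow> bool" where
  "single_interface_layout ri kH kL k1 k2 \<xi> \<longleftrightarrow>
     ri \<le> \<xi> \<and> \<xi> \<le> 1 \<and> (k1 = kH \<and> k2 = kL \<or> k1 = kL \<and> k2 = kH)"

text \<open>For \<open>kH = kL\<close> the two placements coincide as pairs \<open>(k1, k2)\<close>; a layout is then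
  admissible as soon as one of the two volume bounds holds.\<close>
definition admissible_layout ::
    "real \<Rightarrow> real \<Rightarrow> real \<Rightarrow> real \<Rightarrow> real \<Rightarrow> real \<Rightarrow> real \<Rightarrow> bool" where
  "admissible_layout ri kH kL \<gamma> k1 k2 \<xi> \<longleftrightarrow>
     ri \<le> \<xi> \<and> \<xi> \<le> 1 \<and>
     (k1 = kH \<and> k2 = kL \<and> \<xi> ^ 3 - ri ^ 3 \<le> \<gamma> * (1 - ri ^ 3) \<or>
      k1 = kL \<and> k2 = kH \<and> 1 - \<xi> ^ 3 \<le> \<gamma> * (1 - ri ^ 3))"

text \<open>Continuity of \<open>p\<close> on the closed interval contains its continuity at \<open>\<xi>\<close> and gives the
  boundary conditions their meaning. Continuity of \<open>v\<close> at \<open>\<xi>\<close> is one-sided when \<open>\<xi>\<close> is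
  an endpoint.\<close>
definition darcy_solution ::
    "real \<Rightarrow> real \<Rightarrow> real \<Rightarrow> real \<Rightarrow> (real \<Rightarrow> real) \<Rightarrow> (real \<Rightarrow> real) \<Rightarrow> bool" where
  "darcy_solution ri k1 k2 \<xi> v p \<longleftrightarrow>
     (\<forall>r. ri < r \<and> r < 1 \<and> r \<noteq> \<xi> \<longrightarrow>
        (\<exists>p'. (p has_real_derivative p') (at r) \<and> 1 / permeability k1 k2 \<xi> r * v r + p' = 0) \<and>
        (\<exists>q'. ((\<lambda>s. s\<^sup>2 * v s) has_real_derivative q') (at r) \<and> 1 / r\<^sup>2 * q' = 0)) \<and>
     p ri = 1 \<and> p 1 = 0 \<and>
     continuous_on {ri..1} p \<and>
     continuous (at \<xi> within {ri..1}) v"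

definition total_dissipation ::
    "real \<Rightarrow> real \<Rightarrow> real \<Rightarrow> real \<Rightarrow> (real \<Rightarrow> real) \<Rightarrow> real" where
  "total_dissipation ri k1 k2 \<xi> v =
     integral {ri..1} (\<lambda>r. 4 * pi * r\<^sup>2 / permeability k1 k2 \<xi> r * (v r)\<^sup>2)"

definition Upsilon_3D :: "real \<Rightarrow> real \<Rightarrow> real \<Rightarrow> real \<Rightarrow> real" where
  "Upsilon_3D ri k1 k2 \<xi> =
     inverse (1 / (k1 * ri) - 1 / k2 + 1 / \<xi> * (1 / k2 - 1 / k1))"

definition xi_hat_3D :: "real \<Rightarrow> real \<Rightarrow> real" where
  "xi_hat_3D ri \<gamma> = root 3 (\<gamma> + (1 - \<gamma>) * ri ^ 3)"

end

theory Submission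
  imports Defs
begin

text \<open>Mass conservation forces \<open>r\<^sup>2 v\<^sub>r\<close> to be a constant \<open>C\<close> on each side of the
  interface, and continuity of \<open>v\<^sub>r\<close> there makes it the same constant on both sides. Darcy's law
  is then Ohm's law: \<open>p = C R\<close>, where \<open>R(r)\<close> is the hydraulic resistance of the layers between
  the radius \<open>r\<close> and the outer boundary, a continuous function with derivative \<open>- 1 / (k r\<^sup>2)\<close>
  off the interface. The unit pressure drop gives \<open>C = 1 / R(r\<^sub>i)\<close>, which is \<open>\<Upsilon>\<close>, and the
  dissipation is \<open>4 \<pi> C\<^sup>2\<close> times the integral of \<open>1 / (k r\<^sup>2)\<close>, that is
  \<open>4 \<pi> C\<^sup>2 R(r\<^sub>i) = 4 \<pi> \<Upsilon>\<close>
  (\<open>darcy_flux\<close>, \<open>darcy_dissipation\<close>).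

  Maximizing dissipation therefore means minimizing the total resistance. Write
  \<open>\<delta> = 1/k\<^sub>L - 1/k\<^sub>H \<ge> 0\<close>. Relative to a shell filled with the high-permeability material, the
  extra resistance is \<open>\<delta> (1/\<xi> - 1)\<close> if the high-permeability material lies inside, and
  \<open>\<delta> (1/r\<^sub>i - 1/\<xi>)\<close> if it lies outside. The first is decreasing in \<open>\<xi>\<close>, so within that
  placement the optimum uses all the allowed volume. For the other placement the two volume bounds
  combine to \<open>1 - \<xi>\<^sub>h\<^sup>3 \<le> \<xi>\<^sup>3 - r\<^sub>i\<^sup>3\<close>, where \<open>\<xi>\<^sub>h\<close> is the optimal radius: the
  low-permeability volume is at least as large, and it sits where \<open>1/r\<close> falls more
  steeply per unit of volume, so it costs at least as much resistance
  (\<open>outer_gap_le_inner_gap\<close>).\<close>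

section \<open>Hydraulic resistance of a layered shell\<close>

text \<open>The formula is the value at \<open>r\<close> of the integral of \<open>1 / (k s\<^sup>2)\<close> over \<open>s\<close> from \<open>r\<close>
  to \<open>1\<close>. Written with \<open>min\<close> and \<open>max\<close> it is continuous without a
  case distinction at the interface, also when the interface is an endpoint.\<close>
definition shell_resistance :: "real \<Rightarrow> real \<Rightarrow> real \<Rightarrow> real \<Rightarrow> real" where
  "shell_resistance k1 k2 \<xi> r = (1 / min r \<xi> - 1 / \<xi>) / k1 + (1 / max r \<xi> - 1) / k2"

lemma shell_resistance_outer: "\<xi> \<le> 1 \<Longrightarrow> shell_resistance k1 k2 \<xi> 1 = 0"
  by (simp add: shell_resistance_def)

lemma Upsilon_3D_eq:
  assumes "ri \<le> \<xi>"
  shows "Upsilon_3D ri k1 k2 \<xi> = 1 / shell_resistance k1 k2 \<xi> ri"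
  using assms
  by (simp add: Upsilon_3D_def shell_resistance_def inverse_eq_divide algebra_simps
      diff_divide_distrib)

lemma shell_resistance_pos:
  assumes "0 < r" "r < 1" "r \<le> \<xi>" "\<xi> \<le> 1" "0 < k1" "0 < k2"
  shows "0 < shell_resistance k1 k2 \<xi> r"
proof -
  have le: "0 \<le> 1 / r - 1 / \<xi>" "0 \<le> 1 / \<xi> - 1"
    using assms by (simp_all add: field_simps)
  have "0 < 1 / r - 1" using assms by simp
  then have "0 < 1 / r - 1 / \<xi> \<or> 0 < 1 / \<xi> - 1" using le by linarith
  then show ?thesis
    using le assms
    by (auto simp: shell_resistance_def intro: add_pos_nonneg add_nonneg_pos)
qed

lemma continuous_on_shell_resistance:
  assumes "0 < a" "0 < \<xi>"
  shows "continuous_on {a..b} (shell_resistance k1 k2 \<xi>)"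
  unfolding shell_resistance_def divide_inverse
  by (intro continuous_intros) (use assms in \<open>auto simp: min_def max_def\<close>)

lemma shell_resistance_deriv:
  assumes "0 < r" "0 < \<xi>" "r \<noteq> \<xi>"
  shows "(shell_resistance k1 k2 \<xi> has_real_derivative
           - (1 / (permeability k1 k2 \<xi> r * r\<^sup>2))) (at r)"
proof (cases "r < \<xi>")
  case True
  have "((\<lambda>s. 1 / s - 1 / \<xi>) has_real_derivative - (1 / r\<^sup>2)) (at r)"
    using assms by (auto intro!: derivative_eq_intros simp: power2_eq_square)
  from DERIV_add[OF DERIV_cdivide[OF this, of k1] DERIV_const]
  have "((\<lambda>s. (1 / s - 1 / \<xi>) / k1 + (1 / \<xi> - 1) / k2) has_real_derivative
      - (1 / (k1 * r\<^sup>2))) (at r)"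
    by (simp add: mult.commute)
  moreover have "\<forall>\<^sub>F s in nhds r. s < \<xi>"
    using True by (intro eventually_nhds_in_open[of "{..<\<xi>}", simplified]) auto
  then have "\<forall>\<^sub>F s in nhds r. (1 / s - 1 / \<xi>) / k1 + (1 / \<xi> - 1) / k2
      = shell_resistance k1 k2 \<xi> s"
    by eventually_elim (simp add: shell_resistance_def)
  ultimately show ?thesis
    using True by (simp add: permeability_def DERIV_cong_ev[OF refl _ refl])
next
  case False
  have "((\<lambda>s. 1 / s - 1) has_real_derivative - (1 / r\<^sup>2)) (at r)"
    using assms by (auto intro!: derivative_eq_intros simp: power2_eq_square)
  from DERIV_cdivide[OF this, of k2]
  have "((\<lambda>s. (1 / s - 1) / k2) has_real_derivative - (1 / (k2 * r\<^sup>2))) (at r)"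
    by (simp add: mult.commute)
  moreover have "\<forall>\<^sub>F s in nhds r. \<xi> < s"
    using False assms by (intro eventually_nhds_in_open[of "{\<xi><..}", simplified]) auto
  then have "\<forall>\<^sub>F s in nhds r. (1 / s - 1) / k2 = shell_resistance k1 k2 \<xi> s"
    by eventually_elim (simp add: shell_resistance_def)
  ultimately show ?thesis
    using False by (simp add: permeability_def DERIV_cong_ev[OF refl _ refl])
qed

section \<open>The Darcy problem\<close>

text \<open>Continuity at an interior interface lets the set of exceptional points in the
  zero-derivative theorem absorb \<open>\<xi>\<close>, so one constant serves both layers. The pressure
  is compared with \<open>C\<close> times the resistance in the same way, now on the closed interval, which
  identifies the constant from the boundary values.\<close>
lemma darcy_flux:
  assumes sol: "darcy_solution ri k1 k2 \<xi> v p"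
    and ri: "0 < ri" "ri < 1" and \<xi>: "ri \<le> \<xi>" "\<xi> \<le> 1"
    and r: "ri < r" "r < 1"
  shows "v r = Upsilon_3D ri k1 k2 \<xi> / r\<^sup>2"
proof -
  define S where "S = {ri<..<1}"
  define w where "w = (\<lambda>s. s\<^sup>2 * v s)"
  define C where "C = w ((ri + 1) / 2)"
  have w': "(w has_real_derivative 0) (at s)" if "s \<in> S - {\<xi>}" for s
    using sol that ri unfolding darcy_solution_def w_def S_def by fastforce
  have cw: "continuous_on S w"
  proof (intro continuous_at_imp_continuous_on ballI)
    fix s assume s: "s \<in> S"
    show "isCont w s"
    proof (cases "s = \<xi>")
      case True
      have "continuous (at s within S) v"
        using sol True unfolding darcy_solution_def S_def
        by (auto intro: continuous_within_subset)
      then have "isCont v s"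
        using s at_within_open[of s S] by (simp add: S_def)
      then show ?thesis unfolding w_def by (intro continuous_intros)
    next
      case False
      then show ?thesis using w' s DERIV_isCont by blast
    qed
  qed
  have wC: "w s = C" if "s \<in> S" for s
  proof (rule has_derivative_zero_unique_strong_convex[of S "{\<xi>}" w "(ri + 1) / 2"])
    fix x assume "x \<in> S - {\<xi>}"
    then show "(w has_derivative (\<lambda>h. 0)) (at x within S)"
      using has_field_derivative_at_within[OF w'] by (simp add: has_field_derivative_def lambda_zero)
  qed (use cw that ri in \<open>auto simp: C_def S_def\<close>)
  define R where "R = shell_resistance k1 k2 \<xi>"
  define g where "g = (\<lambda>s. p s - C * R s)"
  have cg: "continuous_on {ri..1} g"
    using sol ri \<xi> unfolding darcy_solution_def g_def R_def
    by (auto intro!: continuous_intros continuous_on_shell_resistance)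
  have g': "(g has_real_derivative 0) (at s)" if s: "s \<in> {ri..1} - {ri, \<xi>, 1}" for s
  proof -
    have "ri < s \<and> s < 1 \<and> s \<noteq> \<xi>" using s by auto
    then obtain p' where p': "(p has_real_derivative p') (at s)"
      "1 / permeability k1 k2 \<xi> s * v s + p' = 0"
      using sol unfolding darcy_solution_def by blast
    have "v s = C / s\<^sup>2" using wC[of s] s ri by (simp add: w_def S_def field_simps)
    then have "p' = C * (- (1 / (permeability k1 k2 \<xi> s * s\<^sup>2)))"
      using p'(2) by simp
    then show ?thesis
      unfolding g_def R_def
      using DERIV_diff[OF p'(1) DERIV_cmult[OF shell_resistance_deriv[of s \<xi> k1 k2], of C]] s ri \<xi>
      by auto
  qed
  have "g 1 = g ri"
  proof (rule has_derivative_zero_unique_strong_convex[of "{ri..1}" "{ri, \<xi>, 1}" g ri])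
    fix x assume "x \<in> {ri..1} - {ri, \<xi>, 1}"
    then show "(g has_derivative (\<lambda>h. 0)) (at x within {ri..1})"
      using has_field_derivative_at_within[OF g'] by (simp add: has_field_derivative_def lambda_zero)
  qed (use cg ri in auto)
  then have "C * R ri = 1"
    using sol \<xi> unfolding g_def R_def darcy_solution_def by (simp add: shell_resistance_outer)
  then have "C = Upsilon_3D ri k1 k2 \<xi>"
    using \<xi> by (auto simp: Upsilon_3D_eq R_def eq_divide_eq)
  then show ?thesis
    using wC[of r] r ri by (simp add: w_def S_def field_simps)
qed

text \<open>The integrand is \<open>4 \<pi> \<Upsilon>\<^sup>2 / (k r\<^sup>2)\<close> off the interface, so the resistance is, up to a
  constant factor, an antiderivative. The fundamental theorem is used in the form that ignores
  the endpoints, where the Darcy equations say nothing about \<open>v\<close>.\<close>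
lemma darcy_dissipation:
  assumes sol: "darcy_solution ri k1 k2 \<xi> v p"
    and ri: "0 < ri" "ri < 1" and \<xi>: "ri \<le> \<xi>" "\<xi> \<le> 1"
  shows "total_dissipation ri k1 k2 \<xi> v = 4 * pi * Upsilon_3D ri k1 k2 \<xi>"
proof -
  define U where "U = Upsilon_3D ri k1 k2 \<xi>"
  define F where "F = (\<lambda>r. - (4 * pi * U\<^sup>2) * shell_resistance k1 k2 \<xi> r)"
  let ?f = "\<lambda>r. 4 * pi * r\<^sup>2 / permeability k1 k2 \<xi> r * (v r)\<^sup>2"
  have "(?f has_integral F 1 - F ri) {ri..1}"
  proof (rule fundamental_theorem_of_calculus_interior_strong[of "{\<xi>}"])
    show "continuous_on {ri..1} F"
      unfolding F_def using ri \<xi> by (intro continuous_intros continuous_on_shell_resistance) auto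
    fix x assume x: "x \<in> {ri<..<1} - {\<xi>}"
    have "v x = U / x\<^sup>2" using darcy_flux[OF sol ri \<xi>] x by (simp add: U_def)
    then have "?f x = - (4 * pi * U\<^sup>2) * (- (1 / (permeability k1 k2 \<xi> x * x\<^sup>2)))"
      using x ri by (simp add: power2_eq_square)
    moreover have "(F has_real_derivative
        - (4 * pi * U\<^sup>2) * (- (1 / (permeability k1 k2 \<xi> x * x\<^sup>2)))) (at x)"
      unfolding F_def using x ri \<xi> by (intro DERIV_cmult shell_resistance_deriv) auto
    ultimately show "(F has_vector_derivative ?f x) (at x)"
      by (simp only: has_real_derivative_iff_has_vector_derivative)
  qed (use ri in auto)
  moreover have "F 1 - F ri = 4 * pi * U"
    using \<xi> by (simp add: F_def U_def shell_resistance_outer Upsilon_3D_eq power2_eq_square)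
  ultimately show ?thesis
    by (simp add: total_dissipation_def U_def integral_unique)
qed

lemma darcy_solution_exists:
  assumes ri: "0 < ri" "ri < 1" and \<xi>: "ri \<le> \<xi>" "\<xi> \<le> 1" and k: "0 < k1" "0 < k2"
  shows "\<exists>v p. darcy_solution ri k1 k2 \<xi> v p"
proof -
  define U where "U = Upsilon_3D ri k1 k2 \<xi>"
  define R where "R = shell_resistance k1 k2 \<xi>"
  have "darcy_solution ri k1 k2 \<xi> (\<lambda>r. U / r\<^sup>2) (\<lambda>r. U * R r)"
    unfolding darcy_solution_def
  proof (intro conjI allI impI)
    fix r assume r: "ri < r \<and> r < 1 \<and> r \<noteq> \<xi>"
    have "((\<lambda>r. U * R r) has_real_derivative
        U * (- (1 / (permeability k1 k2 \<xi> r * r\<^sup>2)))) (at r)"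
      unfolding R_def using r ri \<xi> by (intro DERIV_cmult shell_resistance_deriv) auto
    then show "\<exists>p'. ((\<lambda>r. U * R r) has_real_derivative p') (at r) \<and>
        1 / permeability k1 k2 \<xi> r * (U / r\<^sup>2) + p' = 0"
      by (intro exI conjI) auto
    have "\<forall>\<^sub>F s in nhds r. 0 < s"
      using r ri by (intro eventually_nhds_in_open[of "{0<..}", simplified]) auto
    then have "\<forall>\<^sub>F s in nhds r. s\<^sup>2 * (U / s\<^sup>2) = U"
      by eventually_elim simp
    then have "((\<lambda>s. s\<^sup>2 * (U / s\<^sup>2)) has_real_derivative 0) (at r)"
      by (subst DERIV_cong_ev[OF refl _ refl, where g = "\<lambda>_. U"]) auto
    then show "\<exists>q'. ((\<lambda>s. s\<^sup>2 * (U / s\<^sup>2)) has_real_derivative q') (at r) \<and> 1 / r\<^sup>2 * q' = 0"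
      by auto
  next
    show "U * R ri = 1"
      using shell_resistance_pos[OF ri \<xi> k] \<xi> by (simp add: U_def R_def Upsilon_3D_eq)
    show "U * R 1 = 0" using \<xi> by (simp add: R_def shell_resistance_outer)
    show "continuous_on {ri..1} (\<lambda>r. U * R r)"
      unfolding R_def using ri \<xi> by (intro continuous_intros continuous_on_shell_resistance) auto
    show "continuous (at \<xi> within {ri..1}) (\<lambda>r. U / r\<^sup>2)"
      using ri \<xi> by (intro continuous_intros) auto
  qed
  then show ?thesis by blast
qed

section \<open>Comparing layouts\<close>

lemma xi_hat_3D_cube:
  assumes "0 < ri" "ri < 1" "0 \<le> \<gamma>" "\<gamma> \<le> 1"
  shows "xi_hat_3D ri \<gamma> ^ 3 = \<gamma> + (1 - \<gamma>) * ri ^ 3"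
  unfolding xi_hat_3D_def using assms by (intro real_root_pow_pos2) auto

lemma xi_hat_3D_bounds:
  assumes "0 < ri" "ri < 1" "0 \<le> \<gamma>" "\<gamma> \<le> 1"
  shows "ri \<le> xi_hat_3D ri \<gamma>" "xi_hat_3D ri \<gamma> \<le> 1"
proof -
  have nonneg: "0 \<le> xi_hat_3D ri \<gamma>"
    unfolding xi_hat_3D_def using assms by simp
  have c: "ri ^ 3 \<le> 1" using assms by (simp add: power_le_one)
  have "0 \<le> \<gamma> * (1 - ri ^ 3)" "0 \<le> (1 - \<gamma>) * (1 - ri ^ 3)" using assms c by simp_all
  then have "ri ^ 3 \<le> xi_hat_3D ri \<gamma> ^ 3" "xi_hat_3D ri \<gamma> ^ 3 \<le> 1 ^ 3"
    unfolding xi_hat_3D_cube[OF assms] by (simp_all add: algebra_simps)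
  then show "ri \<le> xi_hat_3D ri \<gamma>" "xi_hat_3D ri \<gamma> \<le> 1"
    using nonneg by (auto intro: power_le_imp_le_base[of _ 2] simp: numeral_eq_Suc power_mono_iff)
qed

text \<open>As a function of the volume coordinate \<open>r\<^sup>3\<close>, \<open>1/r\<close> is convex and decreasing. Hence the
  shell \<open>(a, x)\<close> at the inner boundary, with at least the volume of the shell \<open>(y, 1)\<close> at the
  outer one, sees the larger drop of \<open>1/r\<close>. Algebraically, factoring the differences of cubes reduces
  the claim to \<open>a x (a\<^sup>2 + a x + x\<^sup>2) \<le> y (1 + y + y\<^sup>2)\<close>, which holds term by term because
  \<open>a \<le> y\<close> and \<open>x \<le> 1\<close>.\<close>
lemma outer_gap_le_inner_gap:
  fixes a x y :: real
  assumes a: "0 < a" and x: "a \<le> x" "x \<le> 1" and y: "a \<le> y" "y \<le> 1"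
    and vol: "1 - y ^ 3 \<le> x ^ 3 - a ^ 3"
  shows "1 / y - 1 \<le> 1 / a - 1 / x"
proof -
  define A where "A = a\<^sup>2 + a * x + x\<^sup>2"
  define B where "B = 1 + y + y\<^sup>2"
  have A: "0 < A" using a x by (simp add: A_def add_pos_nonneg)
  have "a * x ^ 3 \<le> y * 1" "a\<^sup>2 * x\<^sup>2 \<le> y\<^sup>2 * 1" "a ^ 3 * x \<le> y ^ 3 * 1"
    using a x y by (intro mult_mono power_mono power_le_one; simp)+
  then have AB: "a * x * A \<le> y * B"
    by (simp add: A_def B_def algebra_simps power2_eq_square power3_eq_cube)
  have "(1 - y) * B \<le> (x - a) * A"
    using vol by (simp add: A_def B_def algebra_simps power2_eq_square power3_eq_cube)
  then have "y * ((1 - y) * B) \<le> y * ((x - a) * A)"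
    using a y by (intro mult_left_mono) auto
  moreover have "(1 - y) * (a * x * A) \<le> (1 - y) * (y * B)"
    using AB y by (intro mult_left_mono) auto
  ultimately have "A * ((1 - y) * (a * x)) \<le> A * (y * (x - a))"
    by (simp add: algebra_simps)
  then have "(1 - y) * (a * x) \<le> y * (x - a)"
    using A by simp
  then show ?thesis using a x y by (simp add: field_simps)
qed

lemma resistance_minimal:
  assumes h: "0 < ri" "ri < 1" "0 < kL" "kL \<le> kH" "0 \<le> \<gamma>" "\<gamma> \<le> 1"
    and adm: "admissible_layout ri kH kL \<gamma> k1 k2 \<xi>"
  shows "shell_resistance kH kL (xi_hat_3D ri \<gamma>) ri \<le> shell_resistance k1 k2 \<xi> ri"
proof -
  define y where "y = xi_hat_3D ri \<gamma>"
  define d where "d = 1 / kL - 1 / kH"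
  have y: "ri \<le> y" "y \<le> 1" and y3: "y ^ 3 = \<gamma> + (1 - \<gamma>) * ri ^ 3"
    unfolding y_def using xi_hat_3D_bounds xi_hat_3D_cube h by auto
  have d: "0 \<le> d" using h by (simp add: d_def field_simps)
  have \<xi>: "ri \<le> \<xi>" "\<xi> \<le> 1" using adm by (auto simp: admissible_layout_def)
  have inner: "shell_resistance kH kL z ri = (1 / ri - 1) / kH + d * (1 / z - 1)"
    if "ri \<le> z" for z
    using that by (simp add: shell_resistance_def d_def algebra_simps diff_divide_distrib)
  have outer: "shell_resistance kL kH \<xi> ri = (1 / ri - 1) / kH + d * (1 / ri - 1 / \<xi>)"
    using \<xi> by (simp add: shell_resistance_def d_def algebra_simps diff_divide_distrib)
  consider (hl) "k1 = kH" "k2 = kL" "\<xi> ^ 3 - ri ^ 3 \<le> \<gamma> * (1 - ri ^ 3)"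
    | (lh) "k1 = kL" "k2 = kH" "1 - \<xi> ^ 3 \<le> \<gamma> * (1 - ri ^ 3)"
    using adm by (auto simp: admissible_layout_def)
  then have "shell_resistance kH kL y ri \<le> shell_resistance k1 k2 \<xi> ri"
  proof cases
    case hl
    then have "\<xi> ^ 3 \<le> y ^ 3" unfolding y3 by (simp add: algebra_simps)
    then have "\<xi> \<le> y"
      using y h \<xi> by (simp add: power_mono_iff)
    then have "1 / y \<le> 1 / \<xi>"
      using h \<xi> by (intro divide_left_mono) auto
    then show ?thesis
      using hl(1,2) inner y(1) \<xi>(1) d by (simp add: mult_left_mono)
  next
    case lh
    then have "1 - y ^ 3 \<le> \<xi> ^ 3 - ri ^ 3" unfolding y3 by (simp add: algebra_simps)
    then have "1 / y - 1 \<le> 1 / ri - 1 / \<xi>"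
      using outer_gap_le_inner_gap h(1) \<xi> y by blast
    then show ?thesis
      using lh(1,2) inner[OF y(1)] outer d by (simp add: mult_left_mono)
  qed
  then show ?thesis by (simp add: y_def)
qed

theorem mainTheorem5:
  fixes ri kH kL \<gamma> :: real
  assumes "0 < ri" "ri < 1" "0 < kL" "kL \<le> kH" "0 \<le> \<gamma>" "\<gamma> \<le> 1"
  shows
    "(\<forall>k1 k2 \<xi>. single_interface_layout ri kH kL k1 k2 \<xi> \<longrightarrow>
        (\<exists>v p. darcy_solution ri k1 k2 \<xi> v p) \<and>
        (\<forall>v p. darcy_solution ri k1 k2 \<xi> v p \<longrightarrow>
           (\<forall>r. ri < r \<and> r < 1 \<longrightarrow> v r = Upsilon_3D ri k1 k2 \<xi> / r\<^sup>2) \<and>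
           total_dissipation ri k1 k2 \<xi> v = 4 * pi * Upsilon_3D ri k1 k2 \<xi>)) \<and>
     admissible_layout ri kH kL \<gamma> kH kL (xi_hat_3D ri \<gamma>) \<and>
     (\<forall>k1 k2 \<xi> v p v' p'.
        admissible_layout ri kH kL \<gamma> k1 k2 \<xi> \<and>
        darcy_solution ri k1 k2 \<xi> v p \<and>
        darcy_solution ri kH kL (xi_hat_3D ri \<gamma>) v' p' \<longrightarrow>
          total_dissipation ri k1 k2 \<xi> v
            \<le> total_dissipation ri kH kL (xi_hat_3D ri \<gamma>) v')"
proof (intro conjI allI impI)
  note ri = assms(1,2)
  have kH: "0 < kH" using assms by linarith
  {
    fix k1 k2 \<xi> assume lay: "single_interface_layout ri kH kL k1 k2 \<xi>"
    then have \<xi>: "ri \<le> \<xi>" "\<xi> \<le> 1" and k: "0 < k1" "0 < k2"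
      using assms(3) kH by (auto simp: single_interface_layout_def)
    show "\<exists>v p. darcy_solution ri k1 k2 \<xi> v p"
      by (rule darcy_solution_exists[OF ri \<xi> k])
    fix v p assume sol: "darcy_solution ri k1 k2 \<xi> v p"
    show "v r = Upsilon_3D ri k1 k2 \<xi> / r\<^sup>2" if "ri < r \<and> r < 1" for r
      using darcy_flux[OF sol ri \<xi>] that by blast
    show "total_dissipation ri k1 k2 \<xi> v = 4 * pi * Upsilon_3D ri k1 k2 \<xi>"
      by (rule darcy_dissipation[OF sol ri \<xi>])
  }
  have y: "ri \<le> xi_hat_3D ri \<gamma>" "xi_hat_3D ri \<gamma> \<le> 1"
    using xi_hat_3D_bounds assms by auto
  show "admissible_layout ri kH kL \<gamma> kH kL (xi_hat_3D ri \<gamma>)"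
    using y xi_hat_3D_cube[OF ri assms(5,6)] by (simp add: admissible_layout_def algebra_simps)
  fix k1 k2 \<xi> v p v' p'
  assume *: "admissible_layout ri kH kL \<gamma> k1 k2 \<xi> \<and> darcy_solution ri k1 k2 \<xi> v p \<and>
    darcy_solution ri kH kL (xi_hat_3D ri \<gamma>) v' p'"
  then have \<xi>: "ri \<le> \<xi>" "\<xi> \<le> 1" by (auto simp: admissible_layout_def)
  have "0 < shell_resistance kH kL (xi_hat_3D ri \<gamma>) ri"
    using shell_resistance_pos[OF ri y kH assms(3)] .
  then have "Upsilon_3D ri k1 k2 \<xi> \<le> Upsilon_3D ri kH kL (xi_hat_3D ri \<gamma>)"
    using resistance_minimal[OF assms, of k1 k2 \<xi>] * \<xi>(1) y(1)
    by (simp add: Upsilon_3D_eq frac_le)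
  then show "total_dissipation ri k1 k2 \<xi> v
      \<le> total_dissipation ri kH kL (xi_hat_3D ri \<gamma>) v'"
    using darcy_dissipation[of ri k1 k2 \<xi> v p]
      darcy_dissipation[of ri kH kL "xi_hat_3D ri \<gamma>" v' p'] * ri \<xi> y by simp
qed

end
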